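(* Let $q$ be odd. There is a constant $C$ such that the following holds. Suppose $E\subseteq\mathbb{F}_q^d$ satisfies $\#E\ge Cq^{d/2}$. If $E$ is $(4,s)$-Salem, then \[ \#D(E)\gtrsim\min\{q,\ q^{1-d}(\#E)^{4s}\}. \] In particular, if $E$ is $(4,1/2)$-Salem, i.e. $\sum_{y\in\mathbb{F}_q^d}|\widehat E(y)|^4\lesssim q^{-3d}(\#E)^2$, then $\#D(E)\gtrsim q$.
   Context: $q$ is a prime power, $\chi$ a fixed non-trivial additive character of $\mathbb{F}_q$. $\widehat E(x)=q^{-d}\sum_{y\in E}\chi(-x\cdot y)$, $\|\widehat E\|_4=\big(q^{-d}\sum_{x\ne0}|\widehat E(x)|^4\big)^{1/4}$. Sets are families indexed by $q$; $A\lesssim B$ means $A\le cB$ with $c$ independent of $q$. $E$ is $(4,s)$-Salem if $\|\widehat E\|_4\lesssim q^{-d}(\#E)^{1-s}$. The distance set is $D(E)=\{\sum_{i=1}^d(x_i-y_i)^2:(x_1,\dots,x_d),(y_1,\dots,y_d)\in E\}\subseteq\mathbb{F}_q$.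
   Formalization: The "i.e." is corrected: (4,1/2)-Salem is shown equivalent to the bound on the sum over y ≠ 0 (with all y it fails, e.g. E = F_q^d); both (4,1/2)-Salem and the displayed bound over all y are shown to imply #D(E) ≳ q. The dimension d is at least 1. *)

theory Defs
  imports "HOL-Algebra.Algebra" "HOL-Number_Theory.Prime_Powers" Complex_Main
begin

text \<open>
  The field with \<open>q\<close> elements is a \<^emph>\<open>term\<close> (a ring record with carrier) rather than a type, since
  the implied constants have to be uniform in \<open>q\<close>.
\<close>

definition nontrivial_additive_character :: "('a, 'm) ring_scheme \<Rightarrow> ('a \<Rightarrow> complex) \<Rightarrow> bool" where
  "nontrivial_additive_character R \<chi> \<longleftrightarrow>
     (\<forall>x\<in>carrier R. cmod (\<chi> x) = 1) \<and>
     (\<forall>x\<in>carrier R. \<forall>y\<in>carrier R. \<chi> (x \<oplus>\<^bsub>R\<^esub> y) = \<chi> x * \<chi> y) \<and>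
     (\<exists>x\<in>carrier R. \<chi> x \<noteq> 1)"

definition vecs :: "('a, 'm) ring_scheme \<Rightarrow> nat \<Rightarrow> (nat \<Rightarrow> 'a) set" where
  "vecs R d = ({..<d} \<rightarrow>\<^sub>E carrier R)"

definition vec_zero :: "('a, 'm) ring_scheme \<Rightarrow> nat \<Rightarrow> nat \<Rightarrow> 'a" where
  "vec_zero R d = (\<lambda>i\<in>{..<d}. \<zero>\<^bsub>R\<^esub>)"

definition dot :: "('a, 'm) ring_scheme \<Rightarrow> nat \<Rightarrow> (nat \<Rightarrow> 'a) \<Rightarrow> (nat \<Rightarrow> 'a) \<Rightarrow> 'a" where
  "dot R d x y = (\<Oplus>\<^bsub>R\<^esub>i\<in>{..<d}. x i \<otimes>\<^bsub>R\<^esub> y i)"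

definition fourier ::
  "('a, 'm) ring_scheme \<Rightarrow> ('a \<Rightarrow> complex) \<Rightarrow> nat \<Rightarrow> (nat \<Rightarrow> 'a) set \<Rightarrow> (nat \<Rightarrow> 'a) \<Rightarrow> complex" where
  "fourier R \<chi> d E x = (1 / of_nat (order R) ^ d) * (\<Sum>y\<in>E. \<chi> (\<ominus>\<^bsub>R\<^esub> dot R d x y))"

definition fourier_norm4 ::
  "('a, 'm) ring_scheme \<Rightarrow> ('a \<Rightarrow> complex) \<Rightarrow> nat \<Rightarrow> (nat \<Rightarrow> 'a) set \<Rightarrow> real" where
  "fourier_norm4 R \<chi> d E =
     ((1 / real (order R) ^ d) *
       (\<Sum>x\<in>vecs R d - {vec_zero R d}. cmod (fourier R \<chi> d E x) ^ 4)) powr (1 / 4)"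

definition distance_set :: "('a, 'm) ring_scheme \<Rightarrow> nat \<Rightarrow> (nat \<Rightarrow> 'a) set \<Rightarrow> 'a set" where
  "distance_set R d E =
     {\<Oplus>\<^bsub>R\<^esub>i\<in>{..<d}. (x i \<ominus>\<^bsub>R\<^esub> y i) [^]\<^bsub>R\<^esub> (2::nat) | x y. x \<in> E \<and> y \<in> E}"

definition lesssim_on :: "nat set \<Rightarrow> (nat \<Rightarrow> real) \<Rightarrow> (nat \<Rightarrow> real) \<Rightarrow> bool" where
  "lesssim_on Q A B \<longleftrightarrow> (\<exists>c>0. \<forall>q\<in>Q. A q \<le> c * B q)"

text \<open>
  A family over an index set \<open>Q\<close> of prime powers: for each \<open>q \<in> Q\<close> a field \<open>F q\<close> with \<open>q\<close>
  elements, a non-trivial additive character \<open>\<chi> q\<close> of it, and a subset \<open>E q\<close> of its \<open>d\<close>-th power.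
\<close>

definition set_family ::
  "nat \<Rightarrow> nat set \<Rightarrow> (nat \<Rightarrow> ('a, 'm) ring_scheme) \<Rightarrow> (nat \<Rightarrow> 'a \<Rightarrow> complex) \<Rightarrow>
    (nat \<Rightarrow> (nat \<Rightarrow> 'a) set) \<Rightarrow> bool" where
  "set_family d Q F \<chi> E \<longleftrightarrow>
     (\<forall>q\<in>Q. primepow q \<and> field (F q) \<and> finite (carrier (F q)) \<and> order (F q) = q \<and>
        nontrivial_additive_character (F q) (\<chi> q) \<and> E q \<subseteq> vecs (F q) d)"

definition salem4 ::
  "nat \<Rightarrow> nat set \<Rightarrow> (nat \<Rightarrow> ('a, 'm) ring_scheme) \<Rightarrow> (nat \<Rightarrow> 'a \<Rightarrow> complex) \<Rightarrow>
    (nat \<Rightarrow> (nat \<Rightarrow> 'a) set) \<Rightarrow> real \<Rightarrow> bool" where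
  "salem4 d Q F \<chi> E s \<longleftrightarrow>
     lesssim_on Q (\<lambda>q. fourier_norm4 (F q) (\<chi> q) d (E q))
       (\<lambda>q. real q powr (- real d) * real (card (E q)) powr (1 - s))"

end

theory Submission
  imports Defs "HOL-Analysis.Convex"
begin

text \<open>
  Let \<open>\<nu>(t)\<close> be the number of pairs of points of \<open>E\<close> at distance \<open>t\<close>; by Cauchy--Schwarz
  \<open>(#E)\<^sup>4 \<le> #D(E) \<cdot> \<Sum>\<nu>(t)\<^sup>2\<close>. Parseval on the field turns \<open>q \<Sum>\<nu>(t)\<^sup>2\<close> into the sum of
  \<open>|T(u)|\<^sup>2\<close> with \<open>T(u) = \<Sum>\<chi>(u |x - y|\<^sup>2)\<close> over \<open>x, y \<in> E\<close>. The term \<open>u = 0\<close> is \<open>(#E)\<^sup>4\<close>. For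
  \<open>u \<noteq> 0\<close> put \<open>w = -1/(4u)\<close>: completing the square shows that \<open>T(u)\<close> is, up to a Gauss sum of modulus
  \<open>q\<^bsup>d/2\<^esup>\<close>, the sum of \<open>|q\<^bsup>d\<^esup> fourier(m)|\<^sup>2 \<chi>(w |m|\<^sup>2)\<close> over all frequencies \<open>m\<close>. A second use of
  Parseval, now in \<open>w\<close>, leaves the \<open>L\<^sup>2\<close> masses of the transform on the spheres \<open>|m|\<^sup>2 = r\<close>. As a
  sphere has at most \<open>2 q\<^bsup>d-1\<^esup>\<close> points, Cauchy--Schwarz bounds these by the fourth moment over
  \<open>m \<noteq> 0\<close>, and the frequency \<open>m = 0\<close> only contributes another multiple of \<open>(#E)\<^sup>4/q\<close>.
\<close>

section \<open>Vectors over a commutative ring and the quadratic form of the dot product\<close>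

definition vec_add :: "('a, 'm) ring_scheme \<Rightarrow> nat \<Rightarrow> (nat \<Rightarrow> 'a) \<Rightarrow> (nat \<Rightarrow> 'a) \<Rightarrow> nat \<Rightarrow> 'a" where
  "vec_add R d x y = (\<lambda>i\<in>{..<d}. x i \<oplus>\<^bsub>R\<^esub> y i)"

definition vec_smult :: "('a, 'm) ring_scheme \<Rightarrow> nat \<Rightarrow> 'a \<Rightarrow> (nat \<Rightarrow> 'a) \<Rightarrow> nat \<Rightarrow> 'a" where
  "vec_smult R d a x = (\<lambda>i\<in>{..<d}. a \<otimes>\<^bsub>R\<^esub> x i)"

text \<open>Built from addition and scaling by minus one, so that the linearity rules for
  \<open>dot\<close> cover differences as well.\<close>

definition vec_diff :: "('a, 'm) ring_scheme \<Rightarrow> nat \<Rightarrow> (nat \<Rightarrow> 'a) \<Rightarrow> (nat \<Rightarrow> 'a) \<Rightarrow> nat \<Rightarrow> 'a" where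
  "vec_diff R d x y = vec_add R d x (vec_smult R d (\<ominus>\<^bsub>R\<^esub> \<one>\<^bsub>R\<^esub>) y)"

context cring
begin

lemma vec_nth_closed [simp]: "x \<in> vecs R d \<Longrightarrow> i < d \<Longrightarrow> x i \<in> carrier R"
  by (auto simp: vecs_def PiE_def Pi_def)

text \<open>Vectors are extensional: off \<open>{..<d}\<close> they all take the same default value.
  The operations use restricted abstractions to stay within such functions.\<close>

lemma vec_eqI:
  assumes "x \<in> vecs R d" "y \<in> vecs R d" "\<And>i. i < d \<Longrightarrow> x i = y i"
  shows "x = y"
  using assms unfolding vecs_def by (intro PiE_ext) auto

lemma vec_zero_closed [simp]: "vec_zero R d \<in> vecs R d"
  by (auto simp: vecs_def vec_zero_def)

lemma vec_add_closed [simp]: "x \<in> vecs R d \<Longrightarrow> y \<in> vecs R d \<Longrightarrow> vec_add R d x y \<in> vecs R d"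
  unfolding vec_add_def vecs_def by (intro restrict_PiE_iff[THEN iffD2]) auto

lemma vec_smult_closed [simp]: "a \<in> carrier R \<Longrightarrow> x \<in> vecs R d \<Longrightarrow> vec_smult R d a x \<in> vecs R d"
  unfolding vec_smult_def vecs_def by (intro restrict_PiE_iff[THEN iffD2]) auto

lemma vec_diff_closed [simp]: "x \<in> vecs R d \<Longrightarrow> y \<in> vecs R d \<Longrightarrow> vec_diff R d x y \<in> vecs R d"
  by (simp add: vec_diff_def)

lemma dot_closed [simp]: "x \<in> vecs R d \<Longrightarrow> y \<in> vecs R d \<Longrightarrow> dot R d x y \<in> carrier R"
  unfolding dot_def by (intro finsum_closed) auto

lemma dot_commute: "x \<in> vecs R d \<Longrightarrow> y \<in> vecs R d \<Longrightarrow> dot R d x y = dot R d y x"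
  unfolding dot_def by (intro finsum_cong') (auto simp: m_comm)

lemma dot_add_right:
  assumes "x \<in> vecs R d" "y \<in> vecs R d" "z \<in> vecs R d"
  shows "dot R d x (vec_add R d y z) = dot R d x y \<oplus> dot R d x z"
proof -
  have "dot R d x (vec_add R d y z) = (\<Oplus>i\<in>{..<d}. x i \<otimes> y i \<oplus> x i \<otimes> z i)"
    unfolding dot_def using assms
    by (intro finsum_cong') (auto simp: vec_add_def r_distr)
  also have "\<dots> = dot R d x y \<oplus> dot R d x z"
    unfolding dot_def using assms by (intro finsum_addf) auto
  finally show ?thesis .
qed

lemma dot_smult_right:
  assumes "x \<in> vecs R d" "y \<in> vecs R d" "a \<in> carrier R"
  shows "dot R d x (vec_smult R d a y) = a \<otimes> dot R d x y"
proof -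
  have "dot R d x (vec_smult R d a y) = (\<Oplus>i\<in>{..<d}. a \<otimes> (x i \<otimes> y i))"
    unfolding dot_def using assms
    by (intro finsum_cong') (auto simp: vec_smult_def m_lcomm)
  also have "\<dots> = a \<otimes> dot R d x y"
    unfolding dot_def using assms by (intro finsum_rdistr[symmetric]) auto
  finally show ?thesis .
qed

lemma dot_add_left:
  assumes "x \<in> vecs R d" "y \<in> vecs R d" "z \<in> vecs R d"
  shows "dot R d (vec_add R d y z) x = dot R d y x \<oplus> dot R d z x"
  using assms by (simp add: dot_commute[of _ d x] dot_add_right)

lemma dot_smult_left:
  assumes "x \<in> vecs R d" "y \<in> vecs R d" "a \<in> carrier R"
  shows "dot R d (vec_smult R d a y) x = a \<otimes> dot R d y x"
  using assms by (simp add: dot_commute[of _ d x] dot_smult_right)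

lemma dot_diff_right:
  assumes "x \<in> vecs R d" "y \<in> vecs R d" "z \<in> vecs R d"
  shows "dot R d x (vec_diff R d y z) = dot R d x y \<ominus> dot R d x z"
  using assms by (simp add: vec_diff_def dot_add_right dot_smult_right l_minus a_minus_def)

text \<open>The polarisation identity. Its factor \<open>\<one> \<oplus> \<one>\<close> is the
  reason why odd order is required later, when squares are completed and two must be
  invertible.\<close>

lemma dot_self_add:
  assumes "x \<in> vecs R d" "y \<in> vecs R d"
  shows "dot R d (vec_add R d x y) (vec_add R d x y) =
    dot R d x x \<oplus> (\<one> \<oplus> \<one>) \<otimes> dot R d x y \<oplus> dot R d y y"
  using assms by (simp add: dot_add_right dot_add_left dot_commute[of y d x] l_distr a_ac)

lemma dot_self_smult:
  assumes "x \<in> vecs R d" "a \<in> carrier R"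
  shows "dot R d (vec_smult R d a x) (vec_smult R d a x) = a \<otimes> a \<otimes> dot R d x x"
  using assms by (simp add: dot_smult_right dot_smult_left m_assoc)

lemma dot_vec_zero:
  assumes "x \<in> vecs R d"
  shows "dot R d x (vec_zero R d) = \<zero>"
proof -
  have "dot R d x (vec_zero R d) = (\<Oplus>i\<in>{..<d}. \<zero>)"
    unfolding dot_def using assms by (intro finsum_cong') (auto simp: vec_zero_def)
  thus ?thesis by simp
qed

lemma dot_self_diff:
  assumes "x \<in> vecs R d" "y \<in> vecs R d"
  shows "dot R d (vec_diff R d x y) (vec_diff R d x y) =
    (\<Oplus>i\<in>{..<d}. (x i \<ominus> y i) [^] (2::nat))"
  unfolding dot_def
proof (rule finsum_cong')
  show "(\<lambda>i. (x i \<ominus> y i) [^] (2::nat)) \<in> {..<d} \<rightarrow> carrier R"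
    using assms by auto
  fix i assume "i \<in> {..<d}"
  then have "vec_diff R d x y i = x i \<ominus> y i" "x i \<ominus> y i \<in> carrier R"
    using assms by (auto simp: vec_diff_def vec_add_def vec_smult_def a_minus_def l_minus)
  then show "vec_diff R d x y i \<otimes> vec_diff R d x y i = (x i \<ominus> y i) [^] (2::nat)"
    by (simp add: numeral_2_eq_2)
qed simp

text \<open>With distances as the image of \<open>E \<times> E\<close> under one quadratic form,
  pairs can be counted fibre by fibre.\<close>

lemma distance_set_eq:
  assumes "E \<subseteq> vecs R d"
  shows "distance_set R d E =
    (\<lambda>(x, y). dot R d (vec_diff R d x y) (vec_diff R d x y)) ` (E \<times> E)"
proof -
  have "distance_set R d E = (\<lambda>(x, y). \<Oplus>i\<in>{..<d}. (x i \<ominus> y i) [^] (2::nat)) ` (E \<times> E)"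
    unfolding distance_set_def by auto
  also have "\<dots> = (\<lambda>(x, y). dot R d (vec_diff R d x y) (vec_diff R d x y)) ` (E \<times> E)"
    by (rule image_cong) (use assms in \<open>auto simp: dot_self_diff subset_iff\<close>)
  finally show ?thesis .
qed

lemma bij_betw_vec_add:
  assumes "z \<in> vecs R d"
  shows "bij_betw (\<lambda>x. vec_add R d x z) (vecs R d) (vecs R d)"
proof (rule bij_betw_byWitness[where f' = "\<lambda>x. vec_diff R d x z"])
  show "\<forall>x\<in>vecs R d. vec_diff R d (vec_add R d x z) z = x"
    using assms
    by (intro ballI vec_eqI; simp) (simp add: vec_diff_def vec_add_def vec_smult_def l_minus a_assoc r_neg)
  show "\<forall>x\<in>vecs R d. vec_add R d (vec_diff R d x z) z = x"
    using assms
    by (intro ballI vec_eqI; simp) (simp add: vec_diff_def vec_add_def vec_smult_def l_minus a_assoc l_neg)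
qed (use assms in auto)

text \<open>Translation invariance drives orthogonality, the completion of the square and the
  modulus of the Gauss sum.\<close>

lemma sum_vecs_shift:
  assumes "z \<in> vecs R d"
  shows "(\<Sum>x\<in>vecs R d. f (vec_add R d x z)) = (\<Sum>x\<in>vecs R d. f x)"
  by (rule sum.reindex_bij_betw[OF bij_betw_vec_add[OF assms]])

end

section \<open>Sizes of spheres, and the invertibility of two\<close>

lemma (in domain) card_square_roots_le: "card {a \<in> carrier R. a \<otimes> a = c} \<le> 2"
proof (cases "{a \<in> carrier R. a \<otimes> a = c} = {}")
  case False
  then obtain b where b: "b \<in> carrier R" "b \<otimes> b = c" by auto
  have "a = b \<or> a = \<ominus> b" if a: "a \<in> carrier R" "a \<otimes> a = c" for a
  proof -
    have "(a \<ominus> b) \<otimes> (a \<oplus> b) = a \<otimes> a \<ominus> b \<otimes> b"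
      using a(1) b(1) by (simp add: a_minus_def) algebra
    also have "\<dots> = \<zero>" using a b by auto
    finally have "a \<ominus> b = \<zero> \<or> a \<oplus> b = \<zero>"
      using a b integral by blast
    thus ?thesis
      using a b by (auto simp: r_right_minus_eq dest: sum_zero_eq_neg)
  qed
  hence "{a \<in> carrier R. a \<otimes> a = c} \<subseteq> {b, \<ominus> b}" by auto
  hence "card {a \<in> carrier R. a \<otimes> a = c} \<le> card {b, \<ominus> b}" by (intro card_mono) auto
  also have "\<dots> \<le> 2" by (simp add: card_insert_if)
  finally show ?thesis .
next
  case True
  show ?thesis unfolding True by simp
qed

lemma finite_vecs [simp]: "finite (carrier R) \<Longrightarrow> finite (vecs R d)"
  by (auto simp: vecs_def intro: finite_PiE)

lemma card_vecs: "card (vecs R d) = order R ^ d"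
  by (simp add: vecs_def card_PiE order_def)

text \<open>Once the first \<open>n\<close> coordinates are chosen, the square of the last one is
  determined, which leaves at most two choices. Writing the dimension as \<open>Suc n\<close> keeps
  the exponent free of truncated subtraction.\<close>

lemma (in domain) card_sphere_le:
  assumes fin: "finite (carrier R)"
  shows "card {x \<in> vecs R (Suc n). dot R (Suc n) x x = r} \<le> 2 * order R ^ n"
proof -
  let ?S = "{x \<in> vecs R (Suc n). dot R (Suc n) x x = r}"
  let ?B = "\<lambda>y. {a \<in> carrier R. a \<otimes> a = r \<ominus> dot R n y y}"
  let ?f = "\<lambda>x. (restrict x {..<n}, x n)"
  have restr: "restrict x {..<n} \<in> vecs R n" if "x \<in> vecs R (Suc n)" for x
    using that by (auto simp: vecs_def)
  have split: "dot R (Suc n) x x = x n \<otimes> x n \<oplus> dot R n (restrict x {..<n}) (restrict x {..<n})"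
    if "x \<in> vecs R (Suc n)" for x
  proof -
    have "dot R n (restrict x {..<n}) (restrict x {..<n}) = (\<Oplus>i\<in>{..<n}. x i \<otimes> x i)"
      unfolding dot_def using that by (intro finsum_cong') auto
    moreover have "dot R (Suc n) x x = x n \<otimes> x n \<oplus> (\<Oplus>i\<in>{..<n}. x i \<otimes> x i)"
      unfolding dot_def lessThan_Suc using that by (intro finsum_insert) auto
    ultimately show ?thesis by simp
  qed
  have "inj_on ?f ?S"
  proof (rule inj_onI)
    fix x y assume x: "x \<in> ?S" and y: "y \<in> ?S" and eq: "?f x = ?f y"
    show "x = y"
    proof (rule vec_eqI)
      fix i assume "i < Suc n"
      show "x i = y i"
      proof (cases "i = n")
        case False
        with \<open>i < Suc n\<close> have "i < n" by simp
        thus ?thesis using eq by (metis lessThan_iff prod.inject restrict_apply')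
      qed (use eq in auto)
    qed (use x y in auto)
  qed
  moreover have "?f ` ?S \<subseteq> (SIGMA y:vecs R n. ?B y)"
  proof (rule image_subsetI)
    fix x assume xS: "x \<in> ?S"
    hence x: "x \<in> vecs R (Suc n)" by simp
    let ?y = "restrict x {..<n}"
    have c: "x n \<in> carrier R" "dot R n ?y ?y \<in> carrier R"
      using x restr[OF x] by auto
    hence "x n \<otimes> x n = (x n \<otimes> x n \<oplus> dot R n ?y ?y) \<ominus> dot R n ?y ?y"
      by (simp add: a_minus_def a_assoc r_neg)
    thus "?f x \<in> (SIGMA y:vecs R n. ?B y)"
      using restr[OF x] c(1) split[OF x] xS by simp
  qed
  moreover have finS: "finite (SIGMA y:vecs R n. ?B y)" using fin by auto
  ultimately have "card ?S \<le> card (SIGMA y:vecs R n. ?B y)"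
    by (rule card_inj_on_le)
  also have "\<dots> = (\<Sum>y\<in>vecs R n. card (?B y))" using fin by (intro card_SigmaI) auto
  also have "\<dots> \<le> (\<Sum>y\<in>vecs R n. 2)" by (intro sum_mono card_square_roots_le)
  finally show ?thesis by (simp add: card_vecs)
qed

text \<open>By Lagrange in the additive group, \<open>order R\<close> copies of one add up to zero;
  if two were zero, an odd number of copies would add up to one instead.\<close>

lemma (in field) two_nonzero_if_odd_order:
  assumes "finite (carrier R)" "odd (order R)"
  shows "\<one> \<oplus> \<one> \<noteq> \<zero>"
proof
  assume two: "\<one> \<oplus> \<one> = \<zero>"
  obtain k where k: "order R = 2 * k + 1" using assms(2) by (elim oddE)
  have "add_pow R (order R) \<one> = \<zero>"
    using add.pow_order_eq_1[of \<one>] by (simp add: order_def)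
  moreover have "add_pow R (order R) \<one> = add_pow R k (add_pow R (2::nat) \<one>) \<oplus> \<one>"
    unfolding k by (simp add: add.nat_pow_pow mult.commute)
  moreover have "add_pow R (2::nat) \<one> = \<zero>"
    using two by (simp add: numeral_2_eq_2)
  ultimately show False by simp
qed

section \<open>Additive characters of a finite field: orthogonality and Parseval\<close>

locale finite_field_character = field R for R (structure) +
  fixes \<chi> :: "'a \<Rightarrow> complex"
  assumes finite_carrier [simp]: "finite (carrier R)"
    and nontrivial: "nontrivial_additive_character R \<chi>"
begin

abbreviation (input) "q \<equiv> real (order R)"

lemma order_pos: "order R > 0"
  using finite_carrier by (auto simp: order_def card_gt_0_iff)

lemma char_add: "x \<in> carrier R \<Longrightarrow> y \<in> carrier R \<Longrightarrow> \<chi> (x \<oplus> y) = \<chi> x * \<chi> y"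
  using nontrivial by (auto simp: nontrivial_additive_character_def)

lemma norm_char [simp]: "x \<in> carrier R \<Longrightarrow> cmod (\<chi> x) = 1"
  using nontrivial by (auto simp: nontrivial_additive_character_def)

lemma char_zero [simp]: "\<chi> \<zero> = 1"
proof -
  have "\<chi> \<zero> * \<chi> \<zero> = \<chi> \<zero>" using char_add[of \<zero> \<zero>] by simp
  moreover have "\<chi> \<zero> \<noteq> 0" using norm_char[of \<zero>] by force
  ultimately show ?thesis by simp
qed

lemma char_minus:
  assumes "x \<in> carrier R"
  shows "\<chi> (\<ominus> x) = cnj (\<chi> x)"
proof -
  have "\<chi> x * \<chi> (\<ominus> x) = 1" using char_add[of x "\<ominus> x"] assms by (simp add: r_neg)
  moreover have "\<chi> x * cnj (\<chi> x) = 1"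
    using assms by (simp add: complex_norm_square[symmetric])
  moreover have "\<chi> x \<noteq> 0" using norm_char[OF assms] by force
  ultimately show ?thesis by (metis mult_left_cancel)
qed

lemma char_diff:
  "x \<in> carrier R \<Longrightarrow> y \<in> carrier R \<Longrightarrow> \<chi> (x \<ominus> y) = \<chi> x * cnj (\<chi> y)"
  by (simp add: a_minus_def char_add char_minus)

text \<open>Multiplication by a nonzero \<open>t\<close> is onto, so a point \<open>b\<close> where
  the character differs from one can be written as \<open>a \<otimes> t\<close>.\<close>

lemma char_detects_nonzero:
  assumes "t \<in> carrier R" "t \<noteq> \<zero>"
  obtains a where "a \<in> carrier R" "\<chi> (a \<otimes> t) \<noteq> 1"
proof -
  obtain b where b: "b \<in> carrier R" "\<chi> b \<noteq> 1"
    using nontrivial by (auto simp: nontrivial_additive_character_def)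
  have inv: "inv t \<in> carrier R" "inv t \<otimes> t = \<one>"
    using assms by (auto simp: field_Units)
  show thesis
    by (rule that[of "b \<otimes> inv t"]) (use assms b inv in \<open>auto simp: m_assoc\<close>)
qed

text \<open>If \<open>k\<close> has a nonzero coordinate, shifting \<open>x\<close> by a suitable
  vector \<open>e\<close> supported on that coordinate multiplies the sum by a number other than
  one, so the sum vanishes.\<close>

lemma sum_char_dot:
  assumes k: "k \<in> vecs R d"
  shows "(\<Sum>x\<in>vecs R d. \<chi> (dot R d x k)) = (if k = vec_zero R d then of_nat (order R) ^ d else 0)"
proof (cases "k = vec_zero R d")
  case True
  thus ?thesis by (simp add: dot_vec_zero card_vecs)
next
  case False
  obtain i where i: "i < d" "k i \<noteq> \<zero>"
    using False vec_eqI[OF k vec_zero_closed] by (auto simp: vec_zero_def)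
  obtain a where a: "a \<in> carrier R" "\<chi> (a \<otimes> k i) \<noteq> 1"
    using char_detects_nonzero[of "k i"] i k by auto
  define e where "e = (\<lambda>j\<in>{..<d}. if j = i then a else \<zero>)"
  have e: "e \<in> vecs R d" using a by (auto simp: e_def vecs_def)
  have "dot R d e k = (\<Oplus>j\<in>{..<d}. if i = j then a \<otimes> k j else \<zero>)"
    unfolding dot_def using a k by (intro finsum_cong') (auto simp: e_def)
  also have "\<dots> = a \<otimes> k i"
    using a k i by (intro add.finprod_singleton) auto
  finally have ek: "dot R d e k = a \<otimes> k i" .
  have "(\<Sum>x\<in>vecs R d. \<chi> (dot R d x k)) = (\<Sum>x\<in>vecs R d. \<chi> (dot R d (vec_add R d x e) k))"
    by (rule sum_vecs_shift[OF e, symmetric])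
  also have "\<dots> = (\<Sum>x\<in>vecs R d. \<chi> (dot R d x k)) * \<chi> (a \<otimes> k i)"
    unfolding sum_distrib_right using e k a i
    by (intro sum.cong) (auto simp: dot_add_left char_add ek)
  finally have "(\<Sum>x\<in>vecs R d. \<chi> (dot R d x k)) * (1 - \<chi> (a \<otimes> k i)) = 0"
    by (simp add: algebra_simps)
  thus ?thesis using a False by auto
qed

lemma sum_char_mult:
  assumes t: "t \<in> carrier R"
  shows "(\<Sum>u\<in>carrier R. \<chi> (u \<otimes> t)) = (if t = \<zero> then of_nat (order R) else 0)"
proof (cases "t = \<zero>")
  case True
  thus ?thesis by (simp add: order_def)
next
  case False
  obtain a where a: "a \<in> carrier R" "\<chi> (a \<otimes> t) \<noteq> 1"
    using char_detects_nonzero[OF t False] .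
  have "bij_betw (\<lambda>u. u \<oplus> a) (carrier R) (carrier R)"
    by (rule bij_betw_byWitness[where f' = "\<lambda>u. u \<oplus> \<ominus> a"])
      (use a in \<open>auto simp: a_assoc r_neg l_neg\<close>)
  hence "(\<Sum>u\<in>carrier R. \<chi> (u \<otimes> t)) = (\<Sum>u\<in>carrier R. \<chi> ((u \<oplus> a) \<otimes> t))"
    by (rule sum.reindex_bij_betw[symmetric])
  also have "\<dots> = (\<Sum>u\<in>carrier R. \<chi> (u \<otimes> t)) * \<chi> (a \<otimes> t)"
    unfolding sum_distrib_right using a t
    by (intro sum.cong) (auto simp: l_distr char_add)
  finally have "(\<Sum>u\<in>carrier R. \<chi> (u \<otimes> t)) * (1 - \<chi> (a \<otimes> t)) = 0"
    by (simp add: algebra_simps)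
  thus ?thesis using a False by auto
qed

text \<open>Expanding the square and summing over \<open>u\<close> first, orthogonality keeps only
  the pairs with \<phi> i = \<phi> j. The map and the weights are left general because the result
  serves twice: for pairs of points with weight one, and for frequencies weighted by the squared
  transform.\<close>

lemma parseval:
  fixes f :: "'i \<Rightarrow> real"
  assumes I: "finite I" and \<phi>: "\<And>i. i \<in> I \<Longrightarrow> \<phi> i \<in> carrier R"
  shows "(\<Sum>u\<in>carrier R. (cmod (\<Sum>i\<in>I. of_real (f i) * \<chi> (u \<otimes> \<phi> i)))\<^sup>2) =
    q * (\<Sum>r\<in>carrier R. (\<Sum>i | i \<in> I \<and> \<phi> i = r. f i)\<^sup>2)"
proof -
  have "complex_of_real (\<Sum>u\<in>carrier R. (cmod (\<Sum>i\<in>I. of_real (f i) * \<chi> (u \<otimes> \<phi> i)))\<^sup>2) =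
    (\<Sum>u\<in>carrier R. \<Sum>i\<in>I. \<Sum>j\<in>I. of_real (f i * f j) * \<chi> (u \<otimes> (\<phi> i \<ominus> \<phi> j)))"
    unfolding of_real_sum complex_norm_square cnj_sum sum_product
    using \<phi> by (intro sum.cong refl)
      (auto simp: a_minus_def r_distr r_minus char_add char_minus)
  also have "\<dots> = (\<Sum>i\<in>I. \<Sum>u\<in>carrier R. \<Sum>j\<in>I. of_real (f i * f j) * \<chi> (u \<otimes> (\<phi> i \<ominus> \<phi> j)))"
    by (rule sum.swap)
  also have "\<dots> = (\<Sum>i\<in>I. \<Sum>j\<in>I. \<Sum>u\<in>carrier R. of_real (f i * f j) * \<chi> (u \<otimes> (\<phi> i \<ominus> \<phi> j)))"
    by (intro sum.cong refl sum.swap)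
  also have "\<dots> = (\<Sum>i\<in>I. \<Sum>j\<in>I. of_real (if \<phi> j = \<phi> i then q * (f i * f j) else 0))"
    using \<phi> by (intro sum.cong refl) (auto simp: sum_distrib_left[symmetric] sum_char_mult)
  also have "\<dots> = of_real (\<Sum>i\<in>I. \<Sum>j | j \<in> I \<and> \<phi> j = \<phi> i. q * (f i * f j))"
    unfolding of_real_sum[symmetric] using I by (simp add: sum.If_cases Int_def)
  \<comment> \<open>Sorting the outer index by its value \<open>r\<close> makes both indices run
    over the same fibre, so each fibre contributes a square.\<close>
  also have "(\<Sum>i\<in>I. \<Sum>j | j \<in> I \<and> \<phi> j = \<phi> i. q * (f i * f j)) =
    (\<Sum>r\<in>carrier R. \<Sum>i | i \<in> I \<and> \<phi> i = r. \<Sum>j | j \<in> I \<and> \<phi> j = \<phi> i. q * (f i * f j))"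
    using I \<phi> by (intro sum.group[symmetric]) auto
  also have "\<dots> = (\<Sum>r\<in>carrier R. \<Sum>i | i \<in> I \<and> \<phi> i = r. \<Sum>j | j \<in> I \<and> \<phi> j = r. q * (f i * f j))"
    by (intro sum.cong refl) auto
  also have "\<dots> = q * (\<Sum>r\<in>carrier R. (\<Sum>i | i \<in> I \<and> \<phi> i = r. f i)\<^sup>2)"
    unfolding power2_eq_square sum_product unfolding sum_distrib_left ..
  finally show ?thesis unfolding of_real_eq_iff .
qed

section \<open>Completing the square and the modulus of quadratic Gauss sums\<close>

lemma quadratic_gauss_sum:
  assumes u: "u \<in> carrier R" and z: "z \<in> vecs R d"
    and w: "w \<in> carrier R" "(\<one> \<oplus> \<one>) \<otimes> ((\<one> \<oplus> \<one>) \<otimes> (w \<otimes> u)) = \<ominus> \<one>"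
  shows "(\<Sum>m\<in>vecs R d. \<chi> (w \<otimes> dot R d m m \<ominus> dot R d m z)) =
    (\<Sum>m\<in>vecs R d. \<chi> (w \<otimes> dot R d m m)) * \<chi> (u \<otimes> dot R d z z)"
proof -
  define t where "t = \<one> \<oplus> \<one>"
  have t: "t \<in> carrier R" by (simp add: t_def)
  \<comment> \<open>The hypothesis says 4wu = -1, so e = -2u satisfies 2we = 1. This is the choice
    for which translating \<open>m\<close> by \<open>e\<close> times \<open>z\<close> cancels the
    term linear in \<open>m\<close>.\<close>
  define e where "e = \<ominus> (t \<otimes> u)"
  have e: "e \<in> carrier R" using u t by (simp add: e_def)
  have twe: "t \<otimes> (w \<otimes> e) = \<one>"
    using w t u by (simp add: e_def r_minus t_def[symmetric] m_lcomm)
  define s where "s = vec_smult R d e z"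
  have s: "s \<in> vecs R d" using e z by (simp add: s_def)
  have *: "w \<otimes> dot R d (vec_add R d m s) (vec_add R d m s) \<ominus> dot R d (vec_add R d m s) z =
      w \<otimes> dot R d m m \<oplus> u \<otimes> dot R d z z" if m: "m \<in> vecs R d" for m
  proof -
    define a b c where "a = dot R d m m" and "b = dot R d m z" and "c = dot R d z z"
    have abc: "a \<in> carrier R" "b \<in> carrier R" "c \<in> carrier R"
      using m z by (auto simp: a_def b_def c_def)
    have 1: "dot R d (vec_add R d m s) (vec_add R d m s) = a \<oplus> t \<otimes> (e \<otimes> b) \<oplus> e \<otimes> e \<otimes> c"
      using m z e s by (simp add: dot_self_add s_def dot_self_smult dot_smult_right
          dot_smult_left m_assoc t_def a_def b_def c_def)
    have 2: "dot R d (vec_add R d m s) z = b \<oplus> e \<otimes> c"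
      using m z e s by (simp add: dot_add_left dot_smult_left s_def b_def c_def)
    have 3: "w \<otimes> (t \<otimes> (e \<otimes> b)) = b"
    proof -
      have "w \<otimes> (t \<otimes> (e \<otimes> b)) = (t \<otimes> (w \<otimes> e)) \<otimes> b"
        using w(1) t e abc by (simp add: m_ac)
      thus ?thesis using twe abc by simp
    qed
    \<comment> \<open>Since 2we = 1 and e = -2u, the coefficient wee equals -u, which is u + e. In
      this form the part ec cancels against the shifted linear term and uc remains.\<close>
    have 4: "w \<otimes> (e \<otimes> e \<otimes> c) = u \<otimes> c \<oplus> e \<otimes> c"
    proof -
      have "w \<otimes> (e \<otimes> e \<otimes> c) = \<ominus> (t \<otimes> (w \<otimes> e) \<otimes> (u \<otimes> c))"
        using w(1) t e abc u by (simp add: e_def l_minus r_minus m_ac)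
      also have "\<dots> = \<ominus> (u \<otimes> c)" using twe abc u by simp
      also have "\<dots> = u \<otimes> c \<oplus> e \<otimes> c"
        using u abc by (simp add: e_def t_def l_distr l_minus minus_add r_neg2)
      finally show ?thesis .
    qed
    have "w \<otimes> (a \<oplus> t \<otimes> (e \<otimes> b) \<oplus> e \<otimes> e \<otimes> c) \<ominus> (b \<oplus> e \<otimes> c) =
        w \<otimes> a \<oplus> b \<oplus> (u \<otimes> c \<oplus> e \<otimes> c) \<ominus> (b \<oplus> e \<otimes> c)"
      using w(1) t e abc u 3 4 by (simp add: r_distr)
    also have "\<dots> = w \<otimes> a \<oplus> u \<otimes> c"
      using w(1) t e abc u by algebra
    finally show ?thesis using 1 2 by (simp add: a_def c_def)
  qed
  have "(\<Sum>m\<in>vecs R d. \<chi> (w \<otimes> dot R d m m \<ominus> dot R d m z)) =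
    (\<Sum>m\<in>vecs R d. \<chi> (w \<otimes> dot R d m m \<oplus> u \<otimes> dot R d z z))"
    by (subst sum_vecs_shift[OF s, symmetric]) (simp add: * cong: sum.cong)
  also have "\<dots> = (\<Sum>m\<in>vecs R d. \<chi> (w \<otimes> dot R d m m)) * \<chi> (u \<otimes> dot R d z z)"
    unfolding sum_distrib_right using w u z by (intro sum.cong refl) (simp add: char_add)
  finally show ?thesis .
qed

text \<open>In the double sum over \<open>m\<close> and \<open>n\<close>, the substitution m = h + n
  cancels the terms quadratic in \<open>n\<close> and leaves the character of 2w times the dot
  product of \<open>h\<close> and \<open>n\<close>. Summing over \<open>n\<close> forces 2wh = 0,
  and as 2w is nonzero only h = 0 survives.\<close>

lemma norm_gauss_sum:
  assumes two: "\<one> \<oplus> \<one> \<noteq> \<zero>" and w: "w \<in> carrier R" "w \<noteq> \<zero>"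
  shows "(cmod (\<Sum>m\<in>vecs R d. \<chi> (w \<otimes> dot R d m m)))\<^sup>2 = q ^ d"
proof -
  let ?V = "vecs R d" and ?t = "(\<one> \<oplus> \<one>) \<otimes> w"
  have t: "?t \<in> carrier R" "?t \<noteq> \<zero>" using w two integral_iff by auto
  have smult_zero: "vec_smult R d ?t h = vec_zero R d \<longleftrightarrow> h = vec_zero R d" if h: "h \<in> ?V" for h
  proof
    assume eq: "vec_smult R d ?t h = vec_zero R d"
    show "h = vec_zero R d"
    proof (rule vec_eqI[OF h vec_zero_closed])
      fix i assume i: "i < d"
      have "?t \<otimes> h i = \<zero>" using fun_cong[OF eq, of i] i by (simp add: vec_smult_def vec_zero_def)
      hence "h i = \<zero>" using t h i integral[of ?t "h i"] by auto
      thus "h i = vec_zero R d i" using i by (simp add: vec_zero_def)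
    qed
  next
    assume "h = vec_zero R d"
    thus "vec_smult R d ?t h = vec_zero R d"
      using t by (auto simp: vec_smult_def vec_zero_def)
  qed
  have *: "\<chi> (w \<otimes> dot R d (vec_add R d h n) (vec_add R d h n)) * cnj (\<chi> (w \<otimes> dot R d n n)) =
      \<chi> (w \<otimes> dot R d h h) * \<chi> (dot R d n (vec_smult R d ?t h))"
    if h: "h \<in> ?V" and n: "n \<in> ?V" for h n
  proof -
    have "\<chi> (w \<otimes> dot R d (vec_add R d h n) (vec_add R d h n)) =
      \<chi> (w \<otimes> dot R d h h) * \<chi> (dot R d n (vec_smult R d ?t h)) * \<chi> (w \<otimes> dot R d n n)"
      using h n w by (simp add: dot_self_add r_distr l_distr char_add dot_smult_right dot_commute[of n d h])
    moreover have "\<chi> (w \<otimes> dot R d n n) * cnj (\<chi> (w \<otimes> dot R d n n)) = 1"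
      using n w by (simp add: complex_norm_square[symmetric])
    ultimately show ?thesis by (simp add: mult.assoc)
  qed
  have "complex_of_real ((cmod (\<Sum>m\<in>?V. \<chi> (w \<otimes> dot R d m m)))\<^sup>2) =
     (\<Sum>m\<in>?V. \<Sum>n\<in>?V. \<chi> (w \<otimes> dot R d m m) * cnj (\<chi> (w \<otimes> dot R d n n)))"
    unfolding complex_norm_square cnj_sum sum_product ..
  also have "\<dots> = (\<Sum>n\<in>?V. \<Sum>m\<in>?V. \<chi> (w \<otimes> dot R d m m) * cnj (\<chi> (w \<otimes> dot R d n n)))"
    by (rule sum.swap)
  also have "\<dots> = (\<Sum>n\<in>?V. \<Sum>h\<in>?V. \<chi> (w \<otimes> dot R d h h) * \<chi> (dot R d n (vec_smult R d ?t h)))"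
  proof (rule sum.cong[OF refl])
    fix n assume n: "n \<in> ?V"
    show "(\<Sum>m\<in>?V. \<chi> (w \<otimes> dot R d m m) * cnj (\<chi> (w \<otimes> dot R d n n))) =
      (\<Sum>h\<in>?V. \<chi> (w \<otimes> dot R d h h) * \<chi> (dot R d n (vec_smult R d ?t h)))"
      by (subst sum_vecs_shift[OF n, symmetric]) (use n in \<open>simp add: * cong: sum.cong\<close>)
  qed
  also have "\<dots> = (\<Sum>h\<in>?V. \<Sum>n\<in>?V. \<chi> (w \<otimes> dot R d h h) * \<chi> (dot R d n (vec_smult R d ?t h)))"
    by (rule sum.swap)
  also have "\<dots> = (\<Sum>h\<in>?V. if h = vec_zero R d then \<chi> (w \<otimes> dot R d h h) * of_nat (order R) ^ d else 0)"
    using t by (intro sum.cong refl)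
      (simp add: sum_distrib_left[symmetric] sum_char_dot smult_zero del: mult_eq_0_iff)
  also have "\<dots> = complex_of_real (q ^ d)"
    using w by (simp add: sum.delta dot_vec_zero)
  finally show ?thesis unfolding of_real_eq_iff .
qed


section \<open>From distance counts to masses of the transform on spheres\<close>

lemma norm_fourier_sq:
  assumes E: "E \<subseteq> vecs R d" and m: "m \<in> vecs R d"
  shows "of_real (q ^ (2 * d) * (cmod (fourier R \<chi> d E m))\<^sup>2) =
    (\<Sum>(x, y)\<in>E \<times> E. \<chi> (\<ominus> dot R d m (vec_diff R d x y)))"
proof -
  let ?h = "\<Sum>y\<in>E. \<chi> (\<ominus> dot R d m y)"
  \<comment> \<open>The power of \<open>q\<close> clears the normalisation of
    \<open>fourier\<close>, leaving a plain exponential sum whose square depends on differences of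
    points only.\<close>
  have "q ^ (2 * d) * (cmod (fourier R \<chi> d E m))\<^sup>2 = (cmod ?h)\<^sup>2"
    using order_pos
    by (simp add: fourier_def norm_mult norm_divide norm_power power_mult_distrib power_divide
        power_mult[symmetric] mult.commute)
  also have "complex_of_real \<dots> = (\<Sum>x\<in>E. \<Sum>y\<in>E. \<chi> (\<ominus> dot R d m x) * cnj (\<chi> (\<ominus> dot R d m y)))"
    unfolding complex_norm_square cnj_sum sum_product ..
  also have "\<dots> = (\<Sum>x\<in>E. \<Sum>y\<in>E. \<chi> (\<ominus> dot R d m (vec_diff R d x y)))"
  proof (intro sum.cong refl)
    fix x y assume "x \<in> E" "y \<in> E"
    hence "x \<in> vecs R d" "y \<in> vecs R d" using E by auto
    thus "\<chi> (\<ominus> dot R d m x) * cnj (\<chi> (\<ominus> dot R d m y)) = \<chi> (\<ominus> dot R d m (vec_diff R d x y))"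
      using m by (simp add: dot_diff_right char_minus char_diff)
  qed
  finally show ?thesis by (simp add: sum.cartesian_product)
qed

text \<open>After expanding the squared transform and exchanging sums, the inner sum over
  \<open>m\<close> is a shifted Gauss sum for each difference x - y. Hence q^(2d) times the
  frequency sum is the Gauss sum times the distance sum. Squaring moduli gives q^(4d) on one side
  and q^d on the other, whence the exponent 3d.\<close>

lemma distance_exponential_sum:
  assumes E: "E \<subseteq> vecs R d" and two: "\<one> \<oplus> \<one> \<noteq> \<zero>"
    and u: "u \<in> carrier R"
    and w: "w \<in> carrier R" "(\<one> \<oplus> \<one>) \<otimes> ((\<one> \<oplus> \<one>) \<otimes> (w \<otimes> u)) = \<ominus> \<one>"
  shows "(cmod (\<Sum>(x, y)\<in>E \<times> E. \<chi> (u \<otimes> dot R d (vec_diff R d x y) (vec_diff R d x y))))\<^sup>2 =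
    q ^ (3 * d) *
      (cmod (\<Sum>m\<in>vecs R d. of_real ((cmod (fourier R \<chi> d E m))\<^sup>2) * \<chi> (w \<otimes> dot R d m m)))\<^sup>2"
    (is "(cmod ?T)\<^sup>2 = _ * (cmod ?B)\<^sup>2")
proof -
  let ?V = "vecs R d" and ?z = "\<lambda>(x, y). vec_diff R d x y"
  let ?G = "\<Sum>m\<in>?V. \<chi> (w \<otimes> dot R d m m)"
  have z: "?z p \<in> ?V" if "p \<in> E \<times> E" for p using that E by (auto simp: subset_iff)
  have w0: "w \<noteq> \<zero>"
  proof
    assume "w = \<zero>"
    hence "\<zero> = \<ominus> \<one>" using w(2) u by simp
    thus False by (metis minus_minus minus_zero one_closed zero_not_one)
  qed
  have "of_real (q ^ (2 * d)) * ?B = (\<Sum>m\<in>?V. \<Sum>p\<in>E \<times> E. \<chi> (w \<otimes> dot R d m m \<ominus> dot R d m (?z p)))"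
    unfolding sum_distrib_left
  proof (rule sum.cong[OF refl])
    fix m assume m: "m \<in> ?V"
    have "complex_of_real (q ^ (2 * d)) * (of_real ((cmod (fourier R \<chi> d E m))\<^sup>2) * \<chi> (w \<otimes> dot R d m m))
        = (\<Sum>p\<in>E \<times> E. \<chi> (\<ominus> dot R d m (?z p))) * \<chi> (w \<otimes> dot R d m m)"
      using norm_fourier_sq[OF E m] by (simp add: case_prod_unfold mult.assoc)
    also have "\<dots> = (\<Sum>p\<in>E \<times> E. \<chi> (w \<otimes> dot R d m m \<ominus> dot R d m (?z p)))"
      unfolding sum_distrib_right
    proof (rule sum.cong[OF refl])
      fix p assume "p \<in> E \<times> E"
      from z[OF this] show "\<chi> (\<ominus> dot R d m (?z p)) * \<chi> (w \<otimes> dot R d m m) =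
          \<chi> (w \<otimes> dot R d m m \<ominus> dot R d m (?z p))"
        using m w by (simp add: char_diff char_minus)
    qed
    finally show "complex_of_real (q ^ (2 * d)) *
        (of_real ((cmod (fourier R \<chi> d E m))\<^sup>2) * \<chi> (w \<otimes> dot R d m m)) =
      (\<Sum>p\<in>E \<times> E. \<chi> (w \<otimes> dot R d m m \<ominus> dot R d m (?z p)))" .
  qed
  also have "\<dots> = (\<Sum>p\<in>E \<times> E. \<Sum>m\<in>?V. \<chi> (w \<otimes> dot R d m m \<ominus> dot R d m (?z p)))"
    by (rule sum.swap)
  also have "\<dots> = (\<Sum>p\<in>E \<times> E. ?G * \<chi> (u \<otimes> dot R d (?z p) (?z p)))"
    by (intro sum.cong refl quadratic_gauss_sum[OF u z w])
  also have "\<dots> = ?G * ?T"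
    by (simp add: sum_distrib_left case_prod_unfold)
  finally have "(cmod (of_real (q ^ (2 * d)) * ?B))\<^sup>2 = (cmod (?G * ?T))\<^sup>2" by simp
  hence "q ^ (4 * d) * (cmod ?B)\<^sup>2 = q ^ d * (cmod ?T)\<^sup>2"
    using norm_gauss_sum[OF two w(1) w0, of d]
    by (simp add: norm_mult power_mult_distrib norm_power power_mult[symmetric] mult.commute)
  moreover have "q ^ (4 * d) = q ^ d * q ^ (3 * d)" by (simp flip: power_add)
  ultimately show ?thesis using order_pos by simp
qed

lemma sum_distance_counts_sq_le:
  assumes E: "E \<subseteq> vecs R d" and two: "\<one> \<oplus> \<one> \<noteq> \<zero>"
  shows "q * (\<Sum>r\<in>carrier R. (real (card {(x, y) \<in> E \<times> E.
      dot R d (vec_diff R d x y) (vec_diff R d x y) = r}))\<^sup>2) \<le>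
    real (card E) ^ 4 + q ^ (3 * d + 1) *
      (\<Sum>r\<in>carrier R. (\<Sum>m | m \<in> vecs R d \<and> dot R d m m = r. (cmod (fourier R \<chi> d E m))\<^sup>2)\<^sup>2)"
proof -
  let ?N = "\<lambda>p. dot R d (vec_diff R d (fst p) (snd p)) (vec_diff R d (fst p) (snd p))"
  define T where "T u = (\<Sum>p\<in>E \<times> E. complex_of_real 1 * \<chi> (u \<otimes> ?N p))" for u
  define W where "W w = (\<Sum>m\<in>vecs R d. complex_of_real ((cmod (fourier R \<chi> d E m))\<^sup>2) *
    \<chi> (w \<otimes> dot R d m m))" for w
  \<comment> \<open>This is -1/(4u), the solution \<open>w\<close> of the relation that completing
    the square demands.\<close>
  define f where "f u = \<ominus> (inv ((\<one> \<oplus> \<one>) \<otimes> ((\<one> \<oplus> \<one>) \<otimes> u)))" for u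
  have finE: "finite E" using E finite_subset by fastforce
  have f: "f u \<in> carrier R" "(\<one> \<oplus> \<one>) \<otimes> ((\<one> \<oplus> \<one>) \<otimes> (f u \<otimes> u)) = \<ominus> \<one>"
    if u: "u \<in> carrier R - {\<zero>}" for u
  proof -
    let ?x = "(\<one> \<oplus> \<one>) \<otimes> ((\<one> \<oplus> \<one>) \<otimes> u)"
    have x: "?x \<in> carrier R" "?x \<noteq> \<zero>" using u two by (auto simp: integral_iff)
    hence i: "inv ?x \<in> carrier R" "inv ?x \<otimes> ?x = \<one>" by (auto simp: field_Units)
    thus "f u \<in> carrier R" by (simp add: f_def)
    have "(\<one> \<oplus> \<one>) \<otimes> ((\<one> \<oplus> \<one>) \<otimes> (f u \<otimes> u)) = \<ominus> (inv ?x \<otimes> ?x)"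
    proof -
      define t where "t = \<one> \<oplus> \<one>"
      have "t \<in> carrier R" by (simp add: t_def)
      thus ?thesis using i(1) u unfolding f_def t_def[symmetric]
        by (simp add: l_minus r_minus m_lcomm)
    qed
    thus "(\<one> \<oplus> \<one>) \<otimes> ((\<one> \<oplus> \<one>) \<otimes> (f u \<otimes> u)) = \<ominus> \<one>" using i by simp
  qed
  \<comment> \<open>Distinct \<open>u\<close> give distinct \<open>w\<close>, so the sum over
    nonzero \<open>u\<close> can be reindexed without multiplicities as a sum over part of the
    field.\<close>
  have inj: "inj_on f (carrier R - {\<zero>})"
  proof (rule inj_onI)
    fix u v assume u: "u \<in> carrier R - {\<zero>}" and v: "v \<in> carrier R - {\<zero>}" and eq: "f u = f v"
    have w0: "f u \<noteq> \<zero>"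
    proof
      assume "f u = \<zero>"
      hence "\<zero> = \<ominus> \<one>" using f(2)[OF u] u by simp
      thus False by (metis minus_minus minus_zero one_closed zero_not_one)
    qed
    have "(\<one> \<oplus> \<one>) \<otimes> ((\<one> \<oplus> \<one>) \<otimes> (f u \<otimes> u)) = (\<one> \<oplus> \<one>) \<otimes> ((\<one> \<oplus> \<one>) \<otimes> (f u \<otimes> v))"
      using f(2)[OF u] f(2)[OF v] eq by simp
    thus "u = v" using f(1)[OF u] w0 two u v by (simp add: m_lcancel)
  qed
  have N: "?N p \<in> carrier R" if "p \<in> E \<times> E" for p
    using that E by (auto simp: subset_iff)
  have "q * (\<Sum>r\<in>carrier R. (real (card {(x, y) \<in> E \<times> E.
      dot R d (vec_diff R d x y) (vec_diff R d x y) = r}))\<^sup>2) =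
    q * (\<Sum>r\<in>carrier R. (\<Sum>p | p \<in> E \<times> E \<and> ?N p = r. 1)\<^sup>2)"
    by (simp add: case_prod_unfold mem_Times_iff)
  also have "\<dots> = (\<Sum>u\<in>carrier R. (cmod (T u))\<^sup>2)"
    unfolding T_def using parseval[of "E \<times> E" ?N "\<lambda>_. 1", OF _ N] finE by simp
  also have "\<dots> = (cmod (T \<zero>))\<^sup>2 + (\<Sum>u\<in>carrier R - {\<zero>}. (cmod (T u))\<^sup>2)"
    by (intro sum.remove) auto
  also have "T \<zero> = (\<Sum>p\<in>E \<times> E. 1)"
    unfolding T_def using N by (intro sum.cong) auto
  also have "(cmod (\<Sum>p\<in>E \<times> E. 1))\<^sup>2 = real (card E) ^ 4"
    by (simp add: card_cartesian_product norm_mult power_mult_distrib flip: power_add)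
  also have "(\<Sum>u\<in>carrier R - {\<zero>}. (cmod (T u))\<^sup>2) =
      (\<Sum>u\<in>carrier R - {\<zero>}. q ^ (3 * d) * (cmod (W (f u)))\<^sup>2)"
  proof (rule sum.cong[OF refl])
    fix u assume u: "u \<in> carrier R - {\<zero>}"
    show "(cmod (T u))\<^sup>2 = q ^ (3 * d) * (cmod (W (f u)))\<^sup>2"
      using distance_exponential_sum[OF E two _ f[OF u]] u
      unfolding T_def W_def by (simp add: case_prod_unfold)
  qed
  also have "\<dots> = q ^ (3 * d) * (\<Sum>w\<in>f ` (carrier R - {\<zero>}). (cmod (W w))\<^sup>2)"
    by (simp add: sum.reindex[OF inj] sum_distrib_left)
  \<comment> \<open>Adding the missing nonnegative terms lets \<open>w\<close> range over the whole
    field, as the second use of Parseval requires. That use supplies the extra factor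
    \<open>q\<close> in the exponent 3d + 1.\<close>
  also have "\<dots> \<le> q ^ (3 * d) * (\<Sum>w\<in>carrier R. (cmod (W w))\<^sup>2)"
    by (intro mult_left_mono sum_mono2) (use f(1) in auto)
  also have "(\<Sum>w\<in>carrier R. (cmod (W w))\<^sup>2) =
      q * (\<Sum>r\<in>carrier R. (\<Sum>m | m \<in> vecs R d \<and> dot R d m m = r. (cmod (fourier R \<chi> d E m))\<^sup>2)\<^sup>2)"
    unfolding W_def by (intro parseval) auto
  finally show ?thesis by (simp add: mult.assoc mult.left_commute)
qed

text \<open>The zero frequency has the large value #E/q^d and lies on the sphere of radius zero
  only. It is split off by (a + b)^2 \<le> 2a^2 + 2b^2. On the rest, Cauchy--Schwarz with at most
  2q^n points per sphere yields the factor 4q^n.\<close>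

lemma sum_sphere_fourier_sq_le:
  assumes E: "E \<subseteq> vecs R (Suc n)"
  shows "(\<Sum>r\<in>carrier R. (\<Sum>m | m \<in> vecs R (Suc n) \<and> dot R (Suc n) m m = r.
        (cmod (fourier R \<chi> (Suc n) E m))\<^sup>2)\<^sup>2) \<le>
    2 * (real (card E) / q ^ Suc n) ^ 4 + 4 * q ^ n *
      (\<Sum>m\<in>vecs R (Suc n) - {vec_zero R (Suc n)}. cmod (fourier R \<chi> (Suc n) E m) ^ 4)"
proof -
  let ?d = "Suc n"
  let ?V = "vecs R ?d" and ?o = "vec_zero R ?d" and ?F = "\<lambda>m. cmod (fourier R \<chi> ?d E m)"
  let ?S = "\<lambda>r. {m \<in> ?V. dot R ?d m m = r}" and ?S' = "\<lambda>r. {m \<in> ?V - {vec_zero R ?d}. dot R ?d m m = r}"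
  have F0: "?F ?o = real (card E) / q ^ ?d"
  proof -
    have "dot R ?d ?o y = \<zero>" if "y \<in> E" for y
      using that E dot_vec_zero[of y ?d] dot_commute[of y ?d ?o] by auto
    thus ?thesis by (simp add: fourier_def norm_mult norm_divide norm_power)
  qed
  have bound: "(\<Sum>m\<in>?S r. (?F m)\<^sup>2)\<^sup>2 \<le>
      (if r = \<zero> then 2 * ?F ?o ^ 4 else 0) + 4 * q ^ n * (\<Sum>m\<in>?S' r. ?F m ^ 4)"
    (is "?A\<^sup>2 \<le> _") if r: "r \<in> carrier R" for r
  proof -
    define a where "a = (if r = \<zero> then (?F ?o)\<^sup>2 else 0)"
    define b where "b = (\<Sum>m\<in>?S' r. (?F m)\<^sup>2)"
    have A: "?A = a + b"
    proof (cases "r = \<zero>")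
      case True
      hence "?S r = insert ?o (?S' r)" by (auto simp: dot_vec_zero)
      thus ?thesis using True by (simp add: a_def b_def)
    next
      case False
      hence "?S r = ?S' r" by (auto simp: dot_vec_zero)
      thus ?thesis using False by (simp add: a_def b_def)
    qed
    have "(a + b)\<^sup>2 \<le> 2 * a\<^sup>2 + 2 * b\<^sup>2"
      using zero_le_power2[of "a - b"] by (simp add: power2_eq_square algebra_simps)
    moreover have "2 * a\<^sup>2 = (if r = \<zero> then 2 * ?F ?o ^ 4 else 0)"
      by (simp add: a_def flip: power_mult)
    moreover have "b\<^sup>2 \<le> real (card (?S' r)) * (\<Sum>m\<in>?S' r. ?F m ^ 4)"
      unfolding b_def using sum_squared_le_sum_of_squares[of "\<lambda>m. (?F m)\<^sup>2" "?S' r"]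
      by (simp flip: power_mult add: mult.commute)
    moreover have "real (card (?S' r)) * (\<Sum>m\<in>?S' r. ?F m ^ 4) \<le>
        (2 * q ^ n) * (\<Sum>m\<in>?S' r. ?F m ^ 4)"
    proof (intro mult_right_mono sum_nonneg)
      have "card (?S' r) \<le> card (?S r)" by (intro card_mono) auto
      also have "\<dots> \<le> 2 * order R ^ n" by (rule card_sphere_le) simp
      finally have "real (card (?S' r)) \<le> real (2 * order R ^ n)" by linarith
      thus "real (card (?S' r)) \<le> 2 * q ^ n" by simp
    qed auto
    ultimately show ?thesis unfolding A by linarith
  qed
  have "(\<Sum>r\<in>carrier R. (\<Sum>m\<in>?S r. (?F m)\<^sup>2)\<^sup>2) \<le>
    (\<Sum>r\<in>carrier R. (if r = \<zero> then 2 * ?F ?o ^ 4 else 0) + 4 * q ^ n * (\<Sum>m\<in>?S' r. ?F m ^ 4))"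
    by (intro sum_mono bound)
  also have "\<dots> = 2 * ?F ?o ^ 4 + 4 * q ^ n * (\<Sum>r\<in>carrier R. \<Sum>m\<in>?S' r. ?F m ^ 4)"
    by (simp add: sum.distrib sum_distrib_left)
  also have "(\<Sum>r\<in>carrier R. \<Sum>m\<in>?S' r. ?F m ^ 4) = (\<Sum>m\<in>?V - {?o}. ?F m ^ 4)"
    by (intro sum.group) auto
  finally show ?thesis by (simp add: F0)
qed

text \<open>The constant 3 collects one copy of (#E)^4/q from u = 0 and two from the zero frequency.
  The quotient of \<open>q ^ (4 * d)\<close> by \<open>q\<close> arises because q^(3d+1) times the
  sphere factor q^(d-1) is q^(4d), and the bound for the counts is then divided by
  \<open>q\<close>.\<close>

lemma card_distance_set_bound:
  assumes E: "E \<subseteq> vecs R d" and d: "d \<ge> 1" and odd: "odd (order R)"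
  shows "real (card E) ^ 4 \<le> real (card (distance_set R d E)) *
    (3 * real (card E) ^ 4 / q + 4 * (q ^ (4 * d) / q) *
      (\<Sum>m\<in>vecs R d - {vec_zero R d}. cmod (fourier R \<chi> d E m) ^ 4))"
proof -
  obtain n where n: "d = Suc n" using d by (cases d) auto
  let ?N = "\<lambda>p. dot R d (vec_diff R d (fst p) (snd p)) (vec_diff R d (fst p) (snd p))"
  let ?D = "distance_set R d E" and ?X = "real (card E)"
  let ?S = "\<Sum>m\<in>vecs R d - {vec_zero R d}. cmod (fourier R \<chi> d E m) ^ 4"
  define \<nu> where "\<nu> r = real (card {p \<in> E \<times> E. ?N p = r})" for r
  have two: "\<one> \<oplus> \<one> \<noteq> \<zero>" using two_nonzero_if_odd_order odd by simp
  have finE: "finite E" using E finite_subset by fastforce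
  have q: "q \<ge> 1" using order_pos by linarith
  have D: "?D = ?N ` (E \<times> E)"
    using distance_set_eq[OF E] by (simp add: case_prod_unfold)
  have N: "?N p \<in> carrier R" if "p \<in> E \<times> E" for p
    using that E by (auto simp: subset_iff)
  have D_sub: "?D \<subseteq> carrier R" using D N by auto
  have "?X\<^sup>2 = (\<Sum>p\<in>E \<times> E. 1)" by (simp add: power2_eq_square card_cartesian_product)
  also have "\<dots> = (\<Sum>r\<in>?D. \<Sum>p | p \<in> E \<times> E \<and> ?N p = r. 1)"
    using finE D by (intro sum.group[symmetric]) auto
  also have "\<dots> = (\<Sum>r\<in>?D. \<nu> r)" by (simp add: \<nu>_def)
  finally have X2: "?X\<^sup>2 = (\<Sum>r\<in>?D. \<nu> r)" .
  have "?X ^ 4 = (?X\<^sup>2)\<^sup>2" by (simp flip: power_mult)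
  also have "\<dots> = (\<Sum>r\<in>?D. \<nu> r)\<^sup>2" unfolding X2 ..
  also have "\<dots> \<le> real (card ?D) * (\<Sum>r\<in>?D. (\<nu> r)\<^sup>2)"
    using sum_squared_le_sum_of_squares[of \<nu> ?D] by (simp add: mult.commute)
  also have "\<dots> \<le> real (card ?D) * (\<Sum>r\<in>carrier R. (\<nu> r)\<^sup>2)"
    by (intro mult_left_mono sum_mono2 D_sub) auto
  also have "\<dots> \<le> real (card ?D) * (3 * ?X ^ 4 / q + 4 * (q ^ (4 * d) / q) * ?S)"
  proof (intro mult_left_mono)
    have "q * (\<Sum>r\<in>carrier R. (\<nu> r)\<^sup>2) \<le> ?X ^ 4 + q ^ (3 * d + 1) *
      (\<Sum>r\<in>carrier R. (\<Sum>m | m \<in> vecs R d \<and> dot R d m m = r. (cmod (fourier R \<chi> d E m))\<^sup>2)\<^sup>2)"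
      using sum_distance_counts_sq_le[OF E two] by (simp add: \<nu>_def case_prod_unfold mem_Times_iff)
    also have "\<dots> \<le> ?X ^ 4 + q ^ (3 * d + 1) * (2 * (?X / q ^ d) ^ 4 + 4 * q ^ n * ?S)"
      using sum_sphere_fourier_sq_le[of E n] E n by (intro add_left_mono mult_left_mono) auto
    also have "\<dots> = ?X ^ 4 + 2 * ?X ^ 4 * (q ^ (3 * d + 1) / q ^ (4 * d)) + 4 * q ^ (4 * d) * ?S"
    proof -
      have "q ^ (3 * d + 1) * q ^ n = q ^ (4 * d)" by (simp add: n add.commute flip: power_add)
      moreover have "(?X / q ^ d) ^ 4 = ?X ^ 4 / q ^ (4 * d)"
        by (simp add: power_divide mult.commute flip: power_mult)
      ultimately show ?thesis by (simp add: algebra_simps)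
    qed
    also have "\<dots> \<le> ?X ^ 4 + 2 * ?X ^ 4 * 1 + 4 * q ^ (4 * d) * ?S"
    proof (intro add_mono mult_left_mono order_refl)
      \<comment> \<open>The zero frequency carries the factor q^(1-d), which is at most one because
        the dimension is positive.\<close>
      have "q ^ (3 * d + 1) \<le> q ^ (4 * d)" using q d by (intro power_increasing) auto
      thus "q ^ (3 * d + 1) / q ^ (4 * d) \<le> 1" using q by (simp add: divide_le_eq_1)
    qed auto
    finally show "(\<Sum>r\<in>carrier R. (\<nu> r)\<^sup>2) \<le> 3 * ?X ^ 4 / q + 4 * (q ^ (4 * d) / q) * ?S"
      using q by (simp add: field_simps)
  qed auto
  finally show ?thesis .
qed

end

section \<open>From the Salem condition to the size of the distance set\<close>

lemma fourier_norm4_le_iff: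
  fixes R :: "('a, 'm) ring_scheme"
  assumes q: "order R > 0" and n: "N > 0" and c: "c > 0"
  shows "fourier_norm4 R \<chi> d E \<le> c * (real (order R) powr (- real d) * N powr (1 - s)) \<longleftrightarrow>
    (\<Sum>x\<in>vecs R d - {vec_zero R d}. cmod (fourier R \<chi> d E x) ^ 4) \<le>
      c ^ 4 * (real (order R) powr (- 3 * real d) * N powr (4 - 4 * s))"
    (is "_ \<le> ?b \<longleftrightarrow> ?S \<le> _")
proof -
  let ?q = "real (order R)"
  have S: "?S \<ge> 0" by (intro sum_nonneg) auto
  have b: "?b > 0" using q n c by simp
  have "fourier_norm4 R \<chi> d E = root 4 (?S / ?q ^ d)"
    unfolding fourier_norm4_def using S by (subst root_powr_inverse) auto
  moreover have "?b = root 4 (?b ^ 4)" using b by (simp add: real_root_power_cancel)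
  ultimately have "fourier_norm4 R \<chi> d E \<le> ?b \<longleftrightarrow> ?S / ?q ^ d \<le> ?b ^ 4"
    by (metis real_root_le_iff zero_less_numeral)
  also have "\<dots> \<longleftrightarrow> ?S \<le> ?b ^ 4 * ?q ^ d"
    using q by (intro pos_divide_le_eq) simp
  also have "?b ^ 4 = c ^ 4 * (?q powr (4 * - real d) * N powr (4 * (1 - s)))"
    using q n by (simp add: power_mult_distrib powr_power)
  also have "?q ^ d = ?q powr real d" using q by (simp add: powr_realpow)
  \<comment> \<open>The fourth power of the bound has q^(-4d); moving the normalising q^(-d) of the
    norm to the other side turns it into q^(-3d).\<close>
  also have "c ^ 4 * (?q powr (4 * - real d) * N powr (4 * (1 - s))) * ?q powr real d =
      c ^ 4 * (?q powr (4 * - real d + real d) * N powr (4 * (1 - s)))"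
    unfolding powr_add by (simp only: mult_ac)
  also have "4 * - real d + real d = - 3 * real d" by simp
  also have "4 * (1 - s) = 4 - 4 * s" by simp
  finally show ?thesis .
qed

text \<open>The bound on (#E)^4 is multiplied by the minimum \<open>M\<close>. Each entry of the
  minimum handles one term: M \<le> q absorbs (#E)^4/q, and the other entry absorbs the fourth
  moment. Dividing by (#E)^4, which is positive, leaves 3 + 4K.\<close>

lemma min_le_card_distance_set:
  fixes R :: "('a, 'm) ring_scheme"
  assumes "finite_field_character R \<chi>" and E: "E \<subseteq> vecs R d" and d: "d \<ge> 1"
    and odd: "odd (order R)" and X: "card E > 0"
    and S: "(\<Sum>x\<in>vecs R d - {vec_zero R d}. cmod (fourier R \<chi> d E x) ^ 4) \<le>
      K * (real (order R) powr (- 3 * real d) * real (card E) powr (4 - 4 * s))"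
  shows "min (real (order R)) (real (order R) powr (1 - real d) * real (card E) powr (4 * s)) \<le>
    (3 + 4 * K) * real (card (distance_set R d E))"
proof -
  interpret finite_field_character R \<chi> by fact
  let ?X = "real (card E)" and ?D = "real (card (distance_set R d E))"
  let ?S = "\<Sum>x\<in>vecs R d - {vec_zero R d}. cmod (fourier R \<chi> d E x) ^ 4"
  define M where "M = min q (q powr (1 - real d) * ?X powr (4 * s))"
  have q: "q > 0" using order_pos by simp
  have M0: "M \<ge> 0" using q by (simp add: M_def)
  have M1: "M * (?X ^ 4 / q) \<le> ?X ^ 4"
  proof -
    have "M * (?X ^ 4 / q) \<le> q * (?X ^ 4 / q)" by (intro mult_right_mono) (auto simp: M_def)
    thus ?thesis using q by simp
  qed
  have M2: "M * (q ^ (4 * d) / q * ?S) \<le> K * ?X ^ 4"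
  proof -
    have "q ^ (4 * d) / q = q powr (4 * real d - 1)"
      using q powr_realpow[of q "4 * d"] by (simp add: powr_diff)
    hence "q ^ (4 * d) / q * (K * (q powr (- 3 * real d) * ?X powr (4 - 4 * s))) =
        K * (q powr ((4 * real d - 1) + (- 3 * real d)) * ?X powr (4 - 4 * s))"
      unfolding powr_add by simp
    moreover have "q ^ (4 * d) / q * ?S \<le>
        q ^ (4 * d) / q * (K * (q powr (- 3 * real d) * ?X powr (4 - 4 * s)))"
      using q by (intro mult_left_mono S) auto
    ultimately have le: "q ^ (4 * d) / q * ?S \<le> K * (q powr (real d - 1) * ?X powr (4 - 4 * s))"
      by simp
    \<comment> \<open>The second entry of the minimum is exactly the factor that cancels q^(d-1) and
      raises the power of #E from 4 - 4s to 4.\<close>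
    have "M * (q ^ (4 * d) / q * ?S) \<le>
        (q powr (1 - real d) * ?X powr (4 * s)) * (K * (q powr (real d - 1) * ?X powr (4 - 4 * s)))"
      by (rule mult_mono[OF _ le]) (simp_all add: M_def sum_nonneg)
    also have "\<dots> = K * (q powr ((1 - real d) + (real d - 1)) * ?X powr (4 * s + (4 - 4 * s)))"
      unfolding powr_add by simp
    also have "\<dots> = K * ?X ^ 4" using q X by (simp add: powr_numeral)
    finally show ?thesis .
  qed
  have "M * ?X ^ 4 \<le> M * (?D * (3 * ?X ^ 4 / q + 4 * (q ^ (4 * d) / q) * ?S))"
    using card_distance_set_bound[OF E d odd] M0 by (intro mult_left_mono) auto
  also have "\<dots> = ?D * (3 * (M * (?X ^ 4 / q)) + 4 * (M * (q ^ (4 * d) / q * ?S)))"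
    by (simp add: algebra_simps)
  also have "\<dots> \<le> ?D * (3 * ?X ^ 4 + 4 * (K * ?X ^ 4))"
    using M1 M2 by (intro mult_left_mono add_mono) auto
  also have "\<dots> = ((3 + 4 * K) * ?D) * ?X ^ 4" by (simp add: algebra_simps)
  finally have "M \<le> (3 + 4 * K) * ?D"
    by (rule mult_right_le_imp_le) (use X in simp)
  thus ?thesis unfolding M_def .
qed

text \<open>The Salem condition at 1/2 is characterised by nonzero frequencies only. The zero
  frequency contributes (#E)^4/q^(4d), which is of order at most q^(-3d) (#E)^2 only if #E is of
  order at most q^(d/2). The moment over all frequencies therefore appears as a sufficient
  condition.\<close>

theorem theorem9p3:
  fixes d :: nat
  assumes "d \<ge> 1"
  shows "\<exists>C>0. \<forall>(Q :: nat set) (F :: nat \<Rightarrow> ('a, 'm) ring_scheme) (\<chi> :: nat \<Rightarrow> 'a \<Rightarrow> complex)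
      (E :: nat \<Rightarrow> (nat \<Rightarrow> 'a) set).
    set_family d Q F \<chi> E \<longrightarrow> (\<forall>q\<in>Q. odd q) \<longrightarrow>
    (\<forall>q\<in>Q. real (card (E q)) \<ge> C * real q powr (real d / 2)) \<longrightarrow>
      (\<forall>s :: real. salem4 d Q F \<chi> E s \<longrightarrow>
         lesssim_on Q
           (\<lambda>q. min (real q) (real q powr (1 - real d) * real (card (E q)) powr (4 * s)))
           (\<lambda>q. real (card (distance_set (F q) d (E q))))) \<and>
      (salem4 d Q F \<chi> E (1 / 2) \<longrightarrow>
         lesssim_on Q (\<lambda>q. real q) (\<lambda>q. real (card (distance_set (F q) d (E q))))) \<and>
      (salem4 d Q F \<chi> E (1 / 2) \<longleftrightarrow>
         lesssim_on Q
           (\<lambda>q. \<Sum>y\<in>vecs (F q) d - {vec_zero (F q) d}. cmod (fourier (F q) (\<chi> q) d (E q) y) ^ 4)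
           (\<lambda>q. real q powr (- 3 * real d) * real (card (E q)) ^ 2)) \<and>
      (lesssim_on Q
           (\<lambda>q. \<Sum>y\<in>vecs (F q) d. cmod (fourier (F q) (\<chi> q) d (E q) y) ^ 4)
           (\<lambda>q. real q powr (- 3 * real d) * real (card (E q)) ^ 2) \<longrightarrow>
         lesssim_on Q (\<lambda>q. real q) (\<lambda>q. real (card (distance_set (F q) d (E q)))))"
\<comment> \<open>The constant 1 suffices: the size condition serves to make \<open>E q\<close>
  nonempty and, for s = 1/2, to make the minimum equal to \<open>q\<close>.\<close>
proof (intro exI[of _ "1::real"] conjI[OF zero_less_one] allI impI)
  fix Q :: "nat set" and F :: "nat \<Rightarrow> ('a, 'm) ring_scheme" and \<chi> :: "nat \<Rightarrow> 'a \<Rightarrow> complex"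
    and E :: "nat \<Rightarrow> (nat \<Rightarrow> 'a) set"
  assume fam: "set_family d Q F \<chi> E" and odd: "\<forall>q\<in>Q. odd q"
    and large: "\<forall>q\<in>Q. real (card (E q)) \<ge> 1 * real q powr (real d / 2)"
  let ?X = "\<lambda>q. real (card (E q))" and ?D = "\<lambda>q. real (card (distance_set (F q) d (E q)))"
  let ?c = "\<lambda>q y. cmod (fourier (F q) (\<chi> q) d (E q) y) ^ 4"
  let ?S = "\<lambda>q. \<Sum>y\<in>vecs (F q) d - {vec_zero (F q) d}. ?c q y"
  let ?M = "\<lambda>s q. min (real q) (real q powr (1 - real d) * ?X q powr (4 * s))"
  have qpos: "q > 0" if "q \<in> Q" for q
    using odd that by (auto intro: Nat.gr0I)
  have ord: "order (F q) = q" and sub: "E q \<subseteq> vecs (F q) d"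
    and ffc: "finite_field_character (F q) (\<chi> q)" if "q \<in> Q" for q
    using fam that by (auto simp: set_family_def finite_field_character_def
        finite_field_character_axioms_def)
  have Xpos: "?X q > 0" if "q \<in> Q" for q
  proof -
    have "0 < real q powr (real d / 2)" using qpos[OF that] by simp
    also have "\<dots> \<le> ?X q" using large that by simp
    finally show ?thesis .
  qed
  have salem_iff: "salem4 d Q F \<chi> E s \<longleftrightarrow>
      (\<exists>c>0. \<forall>q\<in>Q. ?S q \<le> c ^ 4 * (real q powr (- 3 * real d) * ?X q powr (4 - 4 * s)))" for s
    unfolding salem4_def lesssim_on_def
  proof (intro arg_cong[of _ _ Ex] ext conj_cong refl ball_cong)
    fix c :: real and q assume "c > 0" and q: "q \<in> Q"
    thus "fourier_norm4 (F q) (\<chi> q) d (E q) \<le> c * (real q powr - real d * ?X q powr (1 - s)) \<longleftrightarrow>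
        ?S q \<le> c ^ 4 * (real q powr (- 3 * real d) * ?X q powr (4 - 4 * s))"
      using fourier_norm4_le_iff[of "F q" "?X q" c "\<chi> q" d "E q" s] Xpos[OF q] qpos[OF q]
      unfolding ord[OF q] by blast
  qed
  have main: "lesssim_on Q (?M s) ?D" if "salem4 d Q F \<chi> E s" for s
  proof -
    from that obtain c where c: "c > 0"
      and le: "\<And>q. q \<in> Q \<Longrightarrow> ?S q \<le> c ^ 4 * (real q powr (- 3 * real d) * ?X q powr (4 - 4 * s))"
      unfolding salem_iff by blast
    have "?M s q \<le> (3 + 4 * c ^ 4) * ?D q" if q: "q \<in> Q" for q
      using min_le_card_distance_set[OF ffc[OF q] sub[OF q] assms, where K = "c ^ 4" and s = s]
        odd q le[OF q] Xpos[OF q] by (simp add: ord[OF q])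
    moreover have "3 + 4 * c ^ 4 > 0" using c by (intro add_pos_pos) auto
    ultimately show ?thesis unfolding lesssim_on_def by blast
  qed
  have half: "lesssim_on Q (\<lambda>q. real q) ?D" if "salem4 d Q F \<chi> E (1 / 2)"
  proof -
    \<comment> \<open>For s = 1/2 the second entry is q^(1-d) (#E)^2, and (#E)^2 \<ge> q^d makes it
      at least \<open>q\<close>.\<close>
    have "?M (1 / 2) q = real q" if q: "q \<in> Q" for q
    proof -
      have "real q powr real d = (real q powr (real d / 2)) powr 2" by (simp add: powr_powr)
      also have "\<dots> \<le> ?X q powr 2" using large q by (intro powr_mono2) auto
      finally have "real q powr (1 - real d) * real q powr real d \<le> real q powr (1 - real d) * ?X q powr 2"
        by (intro mult_left_mono) auto
      hence "real q \<le> real q powr (1 - real d) * ?X q powr 2"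
        using qpos[OF q] by (simp flip: powr_add)
      thus ?thesis by simp
    qed
    thus ?thesis using main[OF that] unfolding lesssim_on_def by simp
  qed
  have half_iff: "salem4 d Q F \<chi> E (1 / 2) \<longleftrightarrow>
      lesssim_on Q ?S (\<lambda>q. real q powr (- 3 * real d) * ?X q ^ 2)"
  proof -
    have "?X q powr (4 - 4 * (1 / 2)) = ?X q ^ 2" if "q \<in> Q" for q
      using Xpos[OF that] by (simp add: powr_numeral)
    hence "salem4 d Q F \<chi> E (1 / 2) \<longleftrightarrow>
        (\<exists>c>0. \<forall>q\<in>Q. ?S q \<le> c ^ 4 * (real q powr (- 3 * real d) * ?X q ^ 2))"
      unfolding salem_iff by (simp cong: ball_cong)
    also have "\<dots> \<longleftrightarrow> (\<exists>c>0. \<forall>q\<in>Q. ?S q \<le> c * (real q powr (- 3 * real d) * ?X q ^ 2))"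
      (is "?L \<longleftrightarrow> ?R")
    proof
      assume ?L
      then obtain c where "c > 0" "\<forall>q\<in>Q. ?S q \<le> c ^ 4 * (real q powr (- 3 * real d) * ?X q ^ 2)" by blast
      thus ?R by (intro exI[of _ "c ^ 4"]) auto
    next
      assume ?R
      then obtain c where "c > 0" "\<forall>q\<in>Q. ?S q \<le> c * (real q powr (- 3 * real d) * ?X q ^ 2)" by blast
      \<comment> \<open>Every positive constant is a fourth power, so the fourth power left by
        unfolding the norm costs nothing.\<close>
      thus ?L by (intro exI[of _ "root 4 c"]) (simp add: real_root_pow_pos2)
    qed
    finally show ?thesis unfolding lesssim_on_def .
  qed
  have full: "lesssim_on Q (\<lambda>q. real q) ?D"
    if hyp: "lesssim_on Q (\<lambda>q. \<Sum>y\<in>vecs (F q) d. ?c q y) (\<lambda>q. real q powr (- 3 * real d) * ?X q ^ 2)"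
  proof -
    \<comment> \<open>Dropping the nonnegative term at the zero frequency reduces the full moment to
      the Salem case.\<close>
    have "?S q \<le> (\<Sum>y\<in>vecs (F q) d. ?c q y)" if "q \<in> Q" for q
      using fam that by (intro sum_mono2) (auto simp: set_family_def)
    hence "lesssim_on Q ?S (\<lambda>q. real q powr (- 3 * real d) * ?X q ^ 2)"
      using hyp unfolding lesssim_on_def by (meson order_trans)
    thus ?thesis using half half_iff by blast
  qed
  show "(\<forall>s. salem4 d Q F \<chi> E s \<longrightarrow> lesssim_on Q (?M s) ?D) \<and>
    (salem4 d Q F \<chi> E (1 / 2) \<longrightarrow> lesssim_on Q (\<lambda>q. real q) ?D) \<and>
    (salem4 d Q F \<chi> E (1 / 2) \<longleftrightarrow>
       lesssim_on Q ?S (\<lambda>q. real q powr (- 3 * real d) * ?X q ^ 2)) \<and>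
    (lesssim_on Q (\<lambda>q. \<Sum>y\<in>vecs (F q) d. ?c q y) (\<lambda>q. real q powr (- 3 * real d) * ?X q ^ 2) \<longrightarrow>
       lesssim_on Q (\<lambda>q. real q) ?D)"
    using main half half_iff full by blast
qed

end
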